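(* Let $k,l$ be positive integers and let $t=a^kb^la$ (the word consisting of $k$ copies of $a$, then $l$ copies of $b$, then one $a$, where $a\ne b$). Then every finite simple graph is $t$-representable.
   Context: Two words are isomorphic if one is obtained from the other by a bijective renaming of letters. For a word $w$ and letters $x,y$, $w|_{xy}$ denotes the subword of $w$ consisting of all occurrences of $x$ and $y$ (in order). A word $u$ over the two letters $\{a,b\}$ occurs in $w|_{xy}$ ($x\neq y$) if some contiguous factor of $w|_{xy}$ is isomorphic to $u$; otherwise $w|_{xy}$ avoids $u$. For a word $t$ on two letters, a graph $G=(V,E)$ is $t$-representable if there is a word $w$ over the alphabet $V$ containing each letter of $V$ at least once such that for all distinct $x,y\in V$, $xy\in E$ if and only if $w|_{xy}$ avoids $t$. *)

theory Defs
  imports Main "HOL-Library.Sublist"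
begin

definition finite_simple_graph :: "'a set \<Rightarrow> 'a set set \<Rightarrow> bool" where
  "finite_simple_graph V E \<longleftrightarrow>
     finite V \<and> (\<forall>e\<in>E. \<exists>x\<in>V. \<exists>y\<in>V. x \<noteq> y \<and> e = {x, y})"

text \<open>The two words may be over different alphabets (types).\<close>

definition word_iso :: "'a list \<Rightarrow> 'b list \<Rightarrow> bool" where
  "word_iso u v \<longleftrightarrow> (\<exists>f. bij_betw f (set u) (set v) \<and> v = map f u)"

definition restrict_word :: "'a list \<Rightarrow> 'a \<Rightarrow> 'a \<Rightarrow> 'a list" where
  "restrict_word w x y = filter (\<lambda>z. z = x \<or> z = y) w"

text \<open>\<open>sublist\<close> is the contiguous factor relation (not \<open>subseq\<close>).\<close>

definition occurs_in :: "'b list \<Rightarrow> 'a list \<Rightarrow> bool" where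
  "occurs_in u v \<longleftrightarrow> (\<exists>s. sublist s v \<and> word_iso u s)"

definition avoids :: "'a list \<Rightarrow> 'b list \<Rightarrow> bool" where
  "avoids v u \<longleftrightarrow> \<not> occurs_in u v"

definition representable :: "'b list \<Rightarrow> 'a set \<Rightarrow> 'a set set \<Rightarrow> bool" where
  "representable t V E \<longleftrightarrow>
     (\<exists>w. set w = V \<and>
        (\<forall>x\<in>V. \<forall>y\<in>V. x \<noteq> y \<longrightarrow> ({x, y} \<in> E \<longleftrightarrow> avoids (restrict_word w x y) t)))"

end

theory Submission
  imports Defs
begin

text \<open>
  If every maximal run of a word is longer than \<open>l\<close>, the word has no factor \<open>c d\<^sup>l c\<close> with
  \<open>c \<noteq> d\<close>, so it avoids \<open>a\<^sup>k b\<^sup>l a\<close>. Put \<open>S = v\<^sub>1\<^sup>L \<dots> v\<^sub>n\<^sup>L\<close> with \<open>L = l + 1\<close>, and append to \<open>S\<close>, for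
  every non-adjacent pair \<open>x, y\<close>, the block \<open>x\<^sup>k y\<^sup>l x\<^sup>L y\<^sup>L S\<close>. The block contains the pattern in \<open>x, y\<close>;
  restricted to any other pair of letters it only has long runs, since the short powers
  \<open>x\<^sup>k\<close> and \<open>y\<^sup>l\<close> are then absorbed by \<open>x\<^sup>L\<close> and \<open>y\<^sup>L\<close>.
\<close>

text \<open>The last run is unconstrained.\<close>

definition long_runs :: "nat \<Rightarrow> 'a list \<Rightarrow> bool" where
  "long_runs l w \<longleftrightarrow>
     (\<forall>p d c q. w = p @ replicate l d @ c # q \<longrightarrow> c \<noteq> d \<longrightarrow> (\<exists>p'. p = p' @ [d]))"

lemma long_runs_Nil [simp]: "long_runs l []"
  by (simp add: long_runs_def)

text \<open>Split on whether \<open>d\<close> starts inside the new block of \<open>e\<close>. If it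
  does, \<open>d = e\<close> and \<open>p\<close> is a power of \<open>e\<close>, so only an empty
  \<open>p\<close> could fail. Otherwise \<open>p\<close> contains the whole block, and dropping it
  leaves a decomposition of \<open>w\<close>.\<close>

lemma long_runs_replicate_append:
  assumes "l \<ge> 1" "m > l" "long_runs l w"
  shows "long_runs l (replicate m e @ w)"
  unfolding long_runs_def
proof (intro allI impI)
  fix p d c q
  assume eq: "replicate m e @ w = p @ replicate l d @ c # q" and "c \<noteq> d"
  show "\<exists>p'. p = p' @ [d]"
  proof (cases "length p < m")
    case True
    have p: "p = replicate (length p) e"
      using arg_cong[OF eq, of "take (length p)"] True by simp
    have "(replicate m e @ w) ! length p = d"
      using \<open>l \<ge> 1\<close> by (simp add: eq nth_append)
    then have "d = e"
      using True by (simp add: nth_append)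
    \<comment> \<open>With \<open>p\<close> empty, \<open>c\<close> would stand at position
      \<open>l\<close>, which still lies in the block of \<open>e\<close> because
      \<open>m > l\<close>.\<close>
    have "p \<noteq> []"
    proof
      assume "p = []"
      then have "(replicate m e @ w) ! l = c"
        by (simp add: eq nth_append)
      then show False
        using \<open>m > l\<close> \<open>c \<noteq> d\<close> \<open>d = e\<close> by (simp add: nth_append)
    qed
    then have "last p = d"
      using p \<open>d = e\<close> by (metis last_replicate length_0_conv)
    then show ?thesis
      using \<open>p \<noteq> []\<close> by (metis append_butlast_last_id)
  next
    case False
    then have "w = drop m p @ replicate l d @ c # q"
      using arg_cong[OF eq, of "drop m"] by simp
    then obtain p' where "drop m p = p' @ [d]"
      using \<open>long_runs l w\<close> \<open>c \<noteq> d\<close> unfolding long_runs_def by blast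
    then have "p = (take m p @ p') @ [d]"
      by (metis append_take_drop_id append.assoc)
    then show ?thesis ..
  qed
qed

text \<open>A renaming matters only through the images \<open>c\<close> of \<open>a\<close> and
  \<open>d\<close> of \<open>b\<close>. Since \<open>l \<ge> 1\<close>, both letters occur in the
  pattern, so injectivity amounts to \<open>c \<noteq> d\<close>.\<close>

lemma occurs_in_replicate_iff:
  assumes "a \<noteq> b" "k \<ge> 1" "l \<ge> 1"
  shows "occurs_in (replicate k a @ replicate l b @ [a]) v \<longleftrightarrow>
    (\<exists>c d. c \<noteq> d \<and> sublist (replicate k c @ replicate l d @ [c]) v)"
proof
  assume "occurs_in (replicate k a @ replicate l b @ [a]) v"
  then obtain f where
    "inj_on f (set (replicate k a @ replicate l b @ [a]))"
    "sublist (map f (replicate k a @ replicate l b @ [a])) v"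
    by (auto simp: occurs_in_def word_iso_def bij_betw_def)
  moreover from this have "f a \<noteq> f b"
    using assms by (auto simp: inj_on_def)
  ultimately show "\<exists>c d. c \<noteq> d \<and> sublist (replicate k c @ replicate l d @ [c]) v"
    by auto
next
  assume "\<exists>c d. c \<noteq> d \<and> sublist (replicate k c @ replicate l d @ [c]) v"
  then obtain c d where cd: "c \<noteq> d" "sublist (replicate k c @ replicate l d @ [c]) v"
    by blast
  have "word_iso (replicate k a @ replicate l b @ [a]) (replicate k c @ replicate l d @ [c])"
    unfolding word_iso_def
  proof (intro exI conjI)
    let ?f = "\<lambda>z. if z = a then c else d"
    show "bij_betw ?f (set (replicate k a @ replicate l b @ [a])) (set (replicate k c @ replicate l d @ [c]))"
      using assms cd(1) by (simp add: bij_betw_def inj_on_def insert_commute)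
    show "replicate k c @ replicate l d @ [c] = map ?f (replicate k a @ replicate l b @ [a])"
      using assms(1) by simp
  qed
  then show "occurs_in (replicate k a @ replicate l b @ [a]) v"
    using cd(2) by (auto simp: occurs_in_def)
qed

text \<open>In such a factor the letter just before the power of \<open>d\<close> is
  \<open>c\<close>, as \<open>k \<ge> 1\<close>, whereas \<open>long_runs\<close> demands
  \<open>d\<close> there.\<close>

lemma long_runs_no_factor:
  assumes "long_runs l w" "c \<noteq> d" "k \<ge> 1"
  shows "\<not> sublist (replicate k c @ replicate l d @ [c]) w"
proof
  assume "sublist (replicate k c @ replicate l d @ [c]) w"
  then obtain p q where "w = (p @ replicate k c) @ replicate l d @ c # q"
    by (auto simp: sublist_def)
  then obtain p' where "p @ replicate k c = p' @ [d]"
    using assms unfolding long_runs_def by blast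
  then show False
    using assms by (metis last_appendR last_replicate last_snoc not_one_le_zero replicate_empty)
qed

definition run_word :: "nat \<Rightarrow> 'a list \<Rightarrow> 'a list" where
  "run_word l xs = concat (map (replicate (Suc l)) xs)"

definition pair_block :: "nat \<Rightarrow> nat \<Rightarrow> 'a list \<Rightarrow> 'a \<times> 'a \<Rightarrow> 'a list" where
  "pair_block k l xs = (\<lambda>(x, y).
     replicate k x @ replicate l y @ replicate (Suc l) x @ replicate (Suc l) y @ run_word l xs)"

lemma set_run_word [simp]: "set (run_word l xs) = set xs"
  by (auto simp: run_word_def)

lemma set_pair_block: "set (pair_block k l xs (x, y)) = {x, y} \<union> set xs"
  by (auto simp: pair_block_def)

text \<open>The filter keeps or deletes each power as a whole, so only powers of length
  \<open>Suc l\<close> are prepended. The tail \<open>w\<close> allows words to be assembled from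
  right to left.\<close>

lemma long_runs_filter_run_word:
  assumes "l \<ge> 1" "long_runs l w"
  shows "long_runs l (filter P (run_word l xs) @ w)"
proof (induction xs)
  case Nil
  then show ?case using assms by (simp add: run_word_def)
next
  case (Cons x xs)
  then show ?case
    using long_runs_replicate_append[OF \<open>l \<ge> 1\<close> lessI Cons.IH, of x]
    by (simp add: run_word_def filter_replicate del: replicate_Suc)
qed

text \<open>At most one of \<open>x\<close> and \<open>y\<close> survives the filter, so its short
  power becomes adjacent to its own long power and merges with it.\<close>

lemma long_runs_filter_pair_block:
  assumes "l \<ge> 1" "long_runs l w" "\<not> (P x \<and> P y)"
  shows "long_runs l (filter P (pair_block k l xs (x, y)) @ w)"
proof -
  let ?w = "filter P (run_word l xs) @ w"
  have w: "long_runs l ?w"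
    using assms by (intro long_runs_filter_run_word)
  \<comment> \<open>Used with \<open>n = k\<close> for \<open>z = x\<close> and with
    \<open>n = l\<close> for \<open>z = y\<close>.\<close>
  have "long_runs l (replicate (n + Suc l) z @ ?w)" for n z
    using assms w by (intro long_runs_replicate_append) auto
  then have "long_runs l (replicate n z @ replicate (Suc l) z @ ?w)" for n z
    by (simp only: replicate_add append.assoc)
  then show ?thesis
    using w assms(3) by (auto simp: pair_block_def filter_replicate simp del: replicate_Suc)
qed

lemma long_runs_filter_pair_blocks:
  assumes "l \<ge> 1" "\<And>x y. (x, y) \<in> set ps \<Longrightarrow> \<not> (P x \<and> P y)"
  shows "long_runs l (filter P (concat (map (pair_block k l xs) ps)))"
  using assms(2)
proof (induction ps)
  case (Cons p ps)
  obtain x y where p: "p = (x, y)"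
    by (cases p)
  have "long_runs l (filter P (concat (map (pair_block k l xs) ps)))"
    using Cons by simp
  then show ?case
    using long_runs_filter_pair_block[OF \<open>l \<ge> 1\<close>] Cons.prems[of x y] by (simp add: p)
qed simp

theorem theorem7:
  fixes k l :: nat and a b :: 'b and V :: "'a set" and E :: "'a set set"
  assumes "k \<ge> 1" and "l \<ge> 1" and "a \<noteq> b"
    and "finite_simple_graph V E"
  shows "representable (replicate k a @ replicate l b @ [a]) V E"
proof -
  obtain xs where xs: "set xs = V"
    using assms(4) finite_list by (auto simp: finite_simple_graph_def)
  \<comment> \<open>Each non-adjacent pair is listed in both orders, so no orientation has to be
    chosen later.\<close>
  define ps where "ps = filter (\<lambda>(x, y). x \<noteq> y \<and> {x, y} \<notin> E) (List.product xs xs)"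
  have set_ps: "set ps = {(x, y). x \<in> V \<and> y \<in> V \<and> x \<noteq> y \<and> {x, y} \<notin> E}"
    by (auto simp: ps_def xs)
  \<comment> \<open>The leading \<open>run_word\<close> supplies every vertex even when
    \<open>ps\<close> is empty.\<close>
  define w where "w = run_word l xs @ concat (map (pair_block k l xs) ps)"
  have "set w = V"
    using set_ps by (auto simp: w_def xs set_pair_block)
  moreover have "{x, y} \<in> E \<longleftrightarrow> avoids (restrict_word w x y) (replicate k a @ replicate l b @ [a])"
    if xy: "x \<in> V" "y \<in> V" "x \<noteq> y" for x y
  proof
    assume "{x, y} \<in> E"
    then have "long_runs l (filter (\<lambda>z. z = x \<or> z = y) (concat (map (pair_block k l xs) ps)))"
      \<comment> \<open>The entries of a pair in \<open>ps\<close> are distinct; if both survived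
        the filter, they would be \<open>x\<close> and \<open>y\<close> in some order, which form an
        edge.\<close>
      using set_ps by (intro long_runs_filter_pair_blocks assms) (auto simp: insert_commute)
    then have "long_runs l (restrict_word w x y)"
      unfolding restrict_word_def w_def filter_append by (intro long_runs_filter_run_word assms)
    note this[THEN long_runs_no_factor, OF _ \<open>k \<ge> 1\<close>]
    then show "avoids (restrict_word w x y) (replicate k a @ replicate l b @ [a])"
      unfolding avoids_def occurs_in_replicate_iff[OF \<open>a \<noteq> b\<close> \<open>k \<ge> 1\<close> \<open>l \<ge> 1\<close>] by blast
  next
    assume av: "avoids (restrict_word w x y) (replicate k a @ replicate l b @ [a])"
    show "{x, y} \<in> E"
    proof (rule ccontr)
      assume "{x, y} \<notin> E"
      then have "(x, y) \<in> set ps"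
        using xy set_ps by simp
      then obtain us vs where "ps = us @ (x, y) # vs"
        by (meson split_list)
      \<comment> \<open>The final letter of the pattern is the first of the \<open>Suc l\<close>
        copies of \<open>x\<close>, so \<open>l\<close> copies remain behind it.\<close>
      then have "w = (run_word l xs @ concat (map (pair_block k l xs) us)) @
          (replicate k x @ replicate l y @ [x]) @
          (replicate l x @ replicate (Suc l) y @ run_word l xs @ concat (map (pair_block k l xs) vs))"
        by (simp add: w_def pair_block_def)
      then obtain us' vs' where "w = us' @ (replicate k x @ replicate l y @ [x]) @ vs'"
        by blast
      then have "restrict_word w x y =
          restrict_word us' x y @ (replicate k x @ replicate l y @ [x]) @ restrict_word vs' x y"
        by (simp add: restrict_word_def filter_replicate)
      then have "sublist (replicate k x @ replicate l y @ [x]) (restrict_word w x y)"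
        unfolding sublist_def by blast
      then show False
        using av assms xy by (auto simp: avoids_def occurs_in_replicate_iff)
    qed
  qed
  ultimately show ?thesis
    unfolding representable_def by blast
qed

end
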